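(* Let $G$ be a countably infinite discrete group, let $X$ be an aperiodic Borel $G$-space and let $E$ be a smooth $G$-invariant equivalence relation on $X$. There exists a partition $\mathcal P$ of $X$ into $4$ Borel sets such that $G\mathcal P=\{gP: g\in G, P\in\mathcal P\}$ separates any two $E$-nonequivalent points of $X$; that is, for all $x,y\in X$ that are not $E$-equivalent there are $g\in G$ and $P\in\mathcal P$ such that exactly one of $x,y$ belongs to $gP$.
   Context: A Borel $G$-space is a standard Borel space $X$ equipped with a Borel action of $G$; it is aperiodic if every orbit is infinite. An equivalence relation $E$ on $X$ is smooth if there is a Borel map $h:X\to\mathbb{R}$ such that for all $x,y\in X$, $xEy \iff h(x)=h(y)$. $E$ is $G$-invariant if any two points in the same $G$-orbit are $E$-equivalent (each $E$-class is a union of $G$-orbits). Pieces of a partition are allowed to be empty. *)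

theory Defs
  imports "HOL-Analysis.Analysis" "HOL-Algebra.Group_Action"
begin

text \<open>Measures serve only as carriers of \<open>\<sigma>\<close>-algebras: \<^term>\<open>space M\<close> is the
  underlying set and \<^term>\<open>sets M\<close> the Borel sets; the values of the measure play no role.\<close>

definition standard_borel :: "'a measure \<Rightarrow> bool" where
  "standard_borel M \<longleftrightarrow>
     (\<exists>T. completely_metrizable_space T \<and> separable_space T \<and> topspace T = space M \<and>
          sets M = sigma_sets (topspace T) {U. openin T U})"

text \<open>The group \<open>G\<close> is discrete, so its Borel structure is the power set of its carrier.\<close>

definition borel_G_space ::
    "('g, 'm) monoid_scheme \<Rightarrow> 'a measure \<Rightarrow> ('g \<Rightarrow> 'a \<Rightarrow> 'a) \<Rightarrow> bool" where
  "borel_G_space G M \<phi> \<longleftrightarrow>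
     standard_borel M \<and>
     group_action G (space M) \<phi> \<and>
     (\<lambda>(g, x). \<phi> g x) \<in> measurable (count_space (carrier G) \<Otimes>\<^sub>M M) M"

definition aperiodic_G_space ::
    "('g, 'm) monoid_scheme \<Rightarrow> 'a measure \<Rightarrow> ('g \<Rightarrow> 'a \<Rightarrow> 'a) \<Rightarrow> bool" where
  "aperiodic_G_space G M \<phi> \<longleftrightarrow>
     borel_G_space G M \<phi> \<and> (\<forall>x\<in>space M. infinite (orbit G \<phi> x))"

definition smooth_equiv :: "'a measure \<Rightarrow> ('a \<times> 'a) set \<Rightarrow> bool" where
  "smooth_equiv M E \<longleftrightarrow>
     equiv (space M) E \<and>
     (\<exists>h\<in>borel_measurable M. \<forall>x\<in>space M. \<forall>y\<in>space M. (x, y) \<in> E \<longleftrightarrow> h x = (h y :: real))"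

definition G_invariant_rel ::
    "('g, 'm) monoid_scheme \<Rightarrow> 'a measure \<Rightarrow> ('g \<Rightarrow> 'a \<Rightarrow> 'a) \<Rightarrow> ('a \<times> 'a) set \<Rightarrow> bool" where
  "G_invariant_rel G M \<phi> E \<longleftrightarrow>
     (\<forall>A\<in>orbits G (space M) \<phi>. \<forall>x\<in>A. \<forall>y\<in>A. (x, y) \<in> E)"

text \<open>An indexed family is used because pieces may be empty, hence possibly repeated.\<close>

definition borel_partition :: "'a measure \<Rightarrow> nat \<Rightarrow> (nat \<Rightarrow> 'a set) \<Rightarrow> bool" where
  "borel_partition M n P \<longleftrightarrow>
     (\<forall>i<n. P i \<in> sets M) \<and> disjoint_family_on P {..<n} \<and> (\<Union>i<n. P i) = space M"

definition translates ::
    "('g, 'm) monoid_scheme \<Rightarrow> ('g \<Rightarrow> 'a \<Rightarrow> 'a) \<Rightarrow> 'a set set \<Rightarrow> 'a set set" where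
  "translates G \<phi> \<P> = {\<phi> g ` P | g P. g \<in> carrier G \<and> P \<in> \<P>}"

definition separates_points :: "'a set set \<Rightarrow> 'a \<Rightarrow> 'a \<Rightarrow> bool" where
  "separates_points \<A> x y \<longleftrightarrow> (\<exists>A\<in>\<A>. (x \<in> A) \<noteq> (y \<in> A))"

end

theory Submission
  imports Defs
begin

text \<open>Given a Borel function \<open>e\<close> into \<open>[0, 1]\<close> with infinitely many values on each orbit, rank the points
  of an orbit by how close \<open>e\<close> comes to its leftmost accumulation point on that orbit: this gives a
  Borel \<open>r\<close> mapping every orbit onto \<open>\<nat>\<close>, and \<open>r x\<close> depends only on the values of \<open>e\<close> along the orbit
  of \<open>x\<close>. Starting from a Borel embedding of \<open>X\<close> one obtains such a \<open>d\<close>. The main step is to find,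
  invariantly, a set \<open>S\<close> of naturals for each orbit such that \<open>A = {x. d x \<in> S}\<close> has infinitely many
  distinct itineraries \<open>{g. g y \<in> A}\<close> on the orbit. Any finite segment of \<open>S\<close> can be prolonged so as to
  force as many itineraries as desired, since otherwise the disjoint fibres of \<open>d\<close> would have boundedly
  many translates; so \<open>S\<close> is built greedily. Coding the \<open>A\<close>-itineraries by reals yields a second
  map \<open>r\<close> onto \<open>\<nat>\<close> on each orbit, now determined by itineraries in \<open>A\<close> alone. With \<open>q\<close> an
  enumeration of the rationals, \<open>B = {x. h x < q (r x)}\<close> records on every orbit all rational upper bounds
  of the invariant \<open>h\<close>, and the four atoms of \<open>A\<close> and \<open>B\<close> form the partition.\<close>

section \<open>Coding and ranking by reals\<close>

definition ternary :: "nat set \<Rightarrow> real" where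
  "ternary S = (\<Sum>n. if n \<in> S then (1/3) ^ Suc n else 0)"

lemma summable_ternary: "summable (\<lambda>n. if n \<in> S then (1/3::real) ^ Suc n else 0)"
proof (rule summable_comparison_test)
  show "\<exists>N. \<forall>n\<ge>N. norm (if n \<in> S then (1/3::real) ^ Suc n else 0) \<le> (1/3) ^ Suc n"
    by auto
  show "summable (\<lambda>n. (1/3::real) ^ Suc n)"
    by (subst summable_Suc_iff) (simp add: summable_geometric)
qed

lemma sums_third_powers: "(\<lambda>i. (1/3::real) ^ Suc (i + n)) sums ((1/3) ^ n / 2)"
  using sums_mult[OF geometric_sums[of "1/3::real"], of "(1/3) ^ Suc n"]
  by (simp add: power_add mult_ac field_simps)

lemma ternary_bounds: "ternary S \<in> {0..1}"
proof -
  have "ternary S \<le> (\<Sum>i. (1/3::real) ^ Suc (i + 0))"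
    unfolding ternary_def
    by (rule suminf_le[OF _ summable_ternary]) (use sums_third_powers[of 0] in \<open>auto simp: sums_iff\<close>)
  also have "\<dots> = 1/2" using sums_third_powers[of 0] by (simp add: sums_iff)
  finally have "ternary S \<le> 1" by simp
  moreover have "0 \<le> ternary S"
    unfolding ternary_def by (rule suminf_nonneg[OF summable_ternary]) auto
  ultimately show ?thesis by simp
qed

text \<open>At the first difference \<open>n\<close>, \<open>S\<close> gains
  \<open>(1/3) ^ Suc n\<close>, while all later digits of \<open>T\<close> together amount to at
  most half of that. In base 2 the tail could make up for the digit; base 3 with digits 0 and 1
  makes the code injective.\<close>

lemma ternary_less:
  assumes "\<And>i. i < n \<Longrightarrow> i \<in> S \<longleftrightarrow> i \<in> T" and "n \<in> S" and "n \<notin> T"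
  shows "ternary T < ternary S"
proof -
  let ?d = "\<lambda>S i. if i \<in> S then (1/3::real) ^ Suc i else 0"
  have split: "ternary S = (\<Sum>i. ?d S (i + Suc n)) + (\<Sum>i<Suc n. ?d S i)" for S
    unfolding ternary_def by (rule suminf_split_initial_segment[OF summable_ternary])
  have "(\<Sum>i. ?d T (i + Suc n)) \<le> (\<Sum>i. (1/3::real) ^ Suc (i + Suc n))"
    by (rule suminf_le)
       (use sums_third_powers[of "Suc n"] summable_ternary[of T, THEN summable_ignore_initial_segment, of "Suc n"]
        in \<open>auto simp: sums_iff\<close>)
  also have "\<dots> = (1/3) ^ Suc n / 2"
    using sums_third_powers[of "Suc n"] by (simp add: sums_iff)
  finally have T: "(\<Sum>i. ?d T (i + Suc n)) \<le> (1/3) ^ Suc n / 2" .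
  have S: "0 \<le> (\<Sum>i. ?d S (i + Suc n))"
    by (rule suminf_nonneg[OF summable_ternary[THEN summable_ignore_initial_segment]]) auto
  have "(\<Sum>i<n. ?d S i) = (\<Sum>i<n. ?d T i)"
    by (rule sum.cong) (auto simp: assms(1))
  then have "(\<Sum>i<Suc n. ?d S i) = (\<Sum>i<Suc n. ?d T i) + (1/3) ^ Suc n"
    using assms(2,3) by simp
  moreover have "0 < (1/3::real) ^ Suc n / 2" by simp
  ultimately show ?thesis
    using T S split[of S] split[of T] by linarith
qed

lemma ternary_eq_iff: "ternary S = ternary T \<longleftrightarrow> S = T"
proof
  assume eq: "ternary S = ternary T"
  show "S = T"
  proof (rule ccontr)
    assume "S \<noteq> T"
    define n where "n = (LEAST i. (i \<in> S) \<noteq> (i \<in> T))"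
    have "\<exists>i. (i \<in> S) \<noteq> (i \<in> T)" using \<open>S \<noteq> T\<close> by blast
    then have n: "(n \<in> S) \<noteq> (n \<in> T)" unfolding n_def by (rule LeastI_ex)
    have "(i \<in> S) = (i \<in> T)" if "i < n" for i
      using not_less_Least that unfolding n_def by blast
    then show False
      using ternary_less[of n S T] ternary_less[of n T S] n eq by force
  qed
qed simp

lemma measurable_ternary:
  assumes [measurable]: "\<And>n. Measurable.pred M (P n)"
  shows "(\<lambda>x. ternary {n. P n x}) \<in> borel_measurable M"
  unfolding ternary_def mem_Collect_eq by measurable

text \<open>Balls of radius \<open>1 / Suc j\<close> about a countable dense set separate points, so
  a point is determined by the set of indices of the balls containing it, and \<open>ternary\<close>
  turns this set into a real.\<close>

lemma standard_borel_embeds_unit_interval: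
  assumes "standard_borel M"
  obtains e :: "'a \<Rightarrow> real" where "e \<in> borel_measurable M" "inj_on e (space M)" "range e \<subseteq> {0..1}"
proof -
  obtain T where T: "completely_metrizable_space T" "separable_space T" "topspace T = space M"
      "sets M = sigma_sets (topspace T) {U. openin T U}"
    using assms unfolding standard_borel_def by blast
  obtain X d where X: "Metric_space X d" "T = Metric_space.mtopology X d"
    using T(1) unfolding completely_metrizable_space_def by blast
  interpret Metric_space X d by fact
  have XM: "X = space M" using T(3) X(2) by simp
  obtain C where C: "countable C" "C \<subseteq> X" "mtopology closure_of C = X"
    using T(2) X(2) unfolding separable_space_def by auto
  define U where "U n = (case prod_decode n of (i, j) \<Rightarrow> mball (from_nat_into C i) (1 / Suc j))" for n
  have "U n \<in> sets M" for n
    unfolding T(4) U_def X(2) by (auto split: prod.split)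
  then have meas: "Measurable.pred M (\<lambda>x. x \<in> U n)" for n
    by (simp add: Measurable.pred_def Int_def[symmetric] sets.Int_space_eq2
        flip: Collect_conj_eq)
  have "inj_on (\<lambda>x. ternary {n. x \<in> U n}) (space M)"
  proof (rule inj_onI, rule ccontr)
    fix x y assume xy: "x \<in> space M" "y \<in> space M" "x \<noteq> y"
      and eq: "ternary {n. x \<in> U n} = ternary {n. y \<in> U n}"
    have iff: "x \<in> U n \<longleftrightarrow> y \<in> U n" for n
      using eq unfolding ternary_eq_iff by blast
    have "0 < d x y / 2" using xy XM by simp
    then obtain j where j: "1 / Suc j < d x y / 2"
      using nat_approx_posE by blast
    have "x \<in> mtopology closure_of C" using C(3) xy XM by simp
    then have "\<exists>c\<in>C. c \<in> mball x (1 / Suc j)"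
      unfolding metric_closure_of by auto
    then obtain c where c: "c \<in> C" "d x c < 1 / Suc j" by auto
    obtain i where i: "from_nat_into C i = c"
      using c(1) C(1) by (metis from_nat_into_surj)
    have "c \<in> X" "x \<in> X" using c C(2) xy XM by auto
    then have "x \<in> U (prod_encode (i, j))"
      using c(2) i by (simp add: U_def commute)
    then have "y \<in> U (prod_encode (i, j))" using iff by blast
    then have "d c y < 1 / Suc j" using i by (simp add: U_def)
    moreover have "d x y \<le> d x c + d c y"
      using triangle xy XM c C(2) by blast
    ultimately show False using c(2) j by linarith
  qed
  moreover have "(\<lambda>x. ternary {n. x \<in> U n}) \<in> borel_measurable M"
    by (rule measurable_ternary[OF meas])
  moreover have "range (\<lambda>x. ternary {n. x \<in> U n}) \<subseteq> {0..1}"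
    using ternary_bounds by blast
  ultimately show thesis by (intro that)
qed

section \<open>Ranking by distance to the leftmost accumulation point\<close>

definition rank :: "nat set \<Rightarrow> nat \<Rightarrow> nat" where
  "rank N n = card {m \<in> N. m < n}"

lemma rank_image_infinite:
  assumes "infinite N"
  shows "rank N ` N = UNIV"
proof -
  have "rank N (enumerate N k) = k" for k
  proof -
    have "{m \<in> N. m < enumerate N k} = enumerate N ` {..<k}"
    proof (intro equalityI subsetI)
      fix m assume "m \<in> {m \<in> N. m < enumerate N k}"
      moreover obtain j where "m = enumerate N j"
        using calculation enumerate_Ex[OF assms] by blast
      ultimately show "m \<in> enumerate N ` {..<k}"
        using enumerate_mono_iff[OF assms] by auto
    qed (use assms enumerate_in_set enumerate_mono_iff in auto)
    then show ?thesis
      unfolding rank_def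
      using card_image[OF inj_on_subset[OF inj_enumerate[OF assms]], of "{..<k}"] by simp
  qed
  then show ?thesis
    using enumerate_in_set[OF assms] by (metis surjI surj_def UNIV_eq_I imageI)
qed

text \<open>For infinite \<open>T \<subseteq> {0..1}\<close> this is the leftmost accumulation point. The supremum ranges over
  rationals to keep it countable, and the value \<open>0\<close> for the others keeps it bounded.\<close>

definition least_limit_point :: "real set \<Rightarrow> real" where
  "least_limit_point T = (SUP q\<in>\<rat>. if q \<le> 1 \<and> finite (T \<inter> {..q}) then max 0 q else 0)"

text \<open>At \<open>t = least_limit_point T\<close> the division by zero makes this \<open>0\<close>.\<close>

definition closeness :: "real set \<Rightarrow> real \<Rightarrow> nat" where
  "closeness T t = nat \<lfloor>1 / \<bar>t - least_limit_point T\<bar>\<rfloor>"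

lemma least_limit_point_bdd:
  "bdd_above ((\<lambda>q. if q \<le> 1 \<and> finite (T \<inter> {..q}) then max 0 q else 0 :: real) ` \<rat>)"
  by (rule bdd_aboveI[of _ 1]) auto

text \<open>Only finitely many points of \<open>T\<close> lie left of the window. Were the window
  finite too, a rational slightly above the limit point would still have finitely many points of
  \<open>T\<close> below it and would push the supremum up.\<close>

lemma infinite_near_least_limit_point:
  assumes "infinite T" and "T \<subseteq> {0..1}" and "\<epsilon> > 0"
  shows "infinite {t \<in> T. \<bar>t - least_limit_point T\<bar> \<le> \<epsilon>}"
proof
  let ?p = "least_limit_point T"
  let ?f = "\<lambda>q. if q \<le> 1 \<and> finite (T \<inter> {..q}) then max 0 q else 0 :: real"
  assume near: "finite {t \<in> T. \<bar>t - ?p\<bar> \<le> \<epsilon>}"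
  have up: "?f q \<le> ?p" if "q \<in> \<rat>" for q
    unfolding least_limit_point_def by (rule cSUP_upper[OF that least_limit_point_bdd])
  have "finite {t \<in> T. t < ?p - \<epsilon>}"
  \<comment> \<open>A \<open>q\<close> whose value exceeds a nonnegative bound has positive value,
    so it is admissible and its value is \<open>q\<close> itself. A negative bound has no points of
    \<open>T\<close> below it.\<close>
  proof (cases "?p - \<epsilon> \<ge> 0")
    case True
    have "?p - \<epsilon> < (SUP q\<in>\<rat>. ?f q)"
      using assms(3) unfolding least_limit_point_def by simp
    then obtain q where q: "q \<in> \<rat>" "?p - \<epsilon> < ?f q"
      by (subst (asm) less_cSUP_iff[OF _ least_limit_point_bdd]) auto
    with True have "finite (T \<inter> {..q})" "?p - \<epsilon> < q"
      by (auto split: if_splits simp: max_def)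
    then show ?thesis by (auto elim!: finite_subset[rotated])
  next
    case False
    then have "{t \<in> T. t < ?p - \<epsilon>} = {}" using assms(2) by force
    then show ?thesis by (metis finite.emptyI)
  qed
  with near have fin: "finite ({t \<in> T. t < ?p - \<epsilon>} \<union> {t \<in> T. \<bar>t - ?p\<bar> \<le> \<epsilon>})" by blast
  then have le: "finite (T \<inter> {..?p + \<epsilon>})"
    by (rule finite_subset[rotated]) auto
  obtain q where q: "q \<in> \<rat>" "?p < q" "q < ?p + \<epsilon>"
    using Rats_dense_in_real[of ?p "?p + \<epsilon>"] assms(3) by auto
  have "finite (T \<inter> {..q})"
    using q(3) by (intro finite_subset[OF _ le]) auto
  moreover have "q \<le> 1"
  proof (rule ccontr)
    assume "\<not> q \<le> 1"
    then have "T \<inter> {..q} = T" using assms(2) by force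
    then show False using calculation assms(1) by simp
  qed
  ultimately show False using up[OF q(1)] q(2) by auto
qed

text \<open>A point of \<open>T\<close> within \<open>1 / Suc k\<close> of the limit point has
  closeness above \<open>k\<close>, unless it is the limit point itself, where closeness is 0.
  Removing that one point leaves infinitely many.\<close>

lemma infinite_closeness:
  assumes "infinite T" and "T \<subseteq> {0..1}"
  shows "infinite (closeness T ` T)"
proof -
  let ?p = "least_limit_point T"
  have "\<exists>n>k. n \<in> closeness T ` T" for k
  proof -
    have "infinite ({t \<in> T. \<bar>t - ?p\<bar> \<le> 1 / Suc k} - {?p})"
      using infinite_near_least_limit_point[OF assms, of "1 / Suc k"] by simp
    then obtain t where t: "t \<in> T" "\<bar>t - ?p\<bar> \<le> 1 / Suc k" "t \<noteq> ?p"
      by (metis (no_types, lifting) Diff_iff finite.emptyI ex_in_conv insertI1 mem_Collect_eq)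
    then have "Suc k \<le> 1 / \<bar>t - ?p\<bar>"
      by (simp add: field_simps)
    then have "k < closeness T t"
      unfolding closeness_def by linarith
    then show ?thesis using t(1) by blast
  qed
  then show ?thesis unfolding infinite_nat_iff_unbounded by blast
qed

section \<open>Unbounded recurrence\<close>

text \<open>For \<open>g\<close> in the group this is the right translate by the inverse of
  \<open>g\<close> of the preimage of \<open>S\<close> under \<delta>, that is, the itinerary of
  \<open>g\<close>. Its image over the carrier is the set of all translates.\<close>

definition recurrence :: "('g, 'm) monoid_scheme \<Rightarrow> ('g \<Rightarrow> nat) \<Rightarrow> nat set \<Rightarrow> 'g \<Rightarrow> 'g set" where
  "recurrence G \<delta> S g = {h \<in> carrier G. \<delta> (h \<otimes>\<^bsub>G\<^esub> g) \<in> S}"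

context group
begin

text \<open>If the fibres of \<open>\<delta>\<close> had boundedly many translates, then in a common finite quotient each
  of them would occupy a fixed positive proportion, contradicting disjointness.\<close>

lemma fibres_recurrence_unbounded:
  fixes \<delta> :: "'a \<Rightarrow> nat"
  assumes surj: "\<delta> ` carrier G = UNIV"
  shows "\<not> (\<forall>i\<ge>m. finite (recurrence G \<delta> {i} ` carrier G) \<and>
                 card (recurrence G \<delta> {i} ` carrier G) \<le> K)"
proof
  let ?V = "\<lambda>i. recurrence G \<delta> {i}"
  assume bound: "\<forall>i\<ge>m. finite (?V i ` carrier G) \<and> card (?V i ` carrier G) \<le> K"
  \<comment> \<open>Each fibre will be seen to occupy at least a share \<open>1/K\<close> of
    \<open>Z\<close>, so \<open>K + 1\<close> disjoint ones are too many.\<close>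
  define I where "I = {m..m + K}"
  \<comment> \<open>The points of the common finite quotient \<open>Z\<close> are the tuples of
    translates by \<open>g\<close>. The map \<open>\<tau> u\<close> below is the action induced on
    them by left multiplication by \<open>u\<close>.\<close>
  define z where "z g = (\<lambda>i\<in>I. ?V i g)" for g
  define Z where "Z = z ` carrier G"
  have V_mem: "h \<in> ?V i g \<longleftrightarrow> \<delta> (h \<otimes> g) = i" if "h \<in> carrier G" for h i g
    using that by (simp add: recurrence_def)
  have "finite (PiE I (\<lambda>i. ?V i ` carrier G))"
    using bound by (intro finite_PiE) (auto simp: I_def)
  moreover have "Z \<subseteq> PiE I (\<lambda>i. ?V i ` carrier G)"
    by (auto simp: Z_def z_def)
  ultimately have finZ: "finite Z" by (rule finite_subset[rotated])
  \<comment> \<open>For \<open>h\<close> in the group and \<open>i\<close> in \<open>I\<close>,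
    these are the tuples \<open>z g\<close> with
    \<open>\<delta> (h \<otimes> g) = i\<close>.\<close>
  define F where "F i h = {\<zeta> \<in> Z. h \<in> \<zeta> i}" for i h
  have finF: "finite (F i h)" for i h using finZ by (simp add: F_def)
  define \<tau> where "\<tau> u \<zeta> = (\<lambda>i\<in>I. {h \<in> carrier G. h \<otimes> u \<in> \<zeta> i})" for u and \<zeta> :: "nat \<Rightarrow> 'a set"
  have \<tau>_z: "\<tau> u (z g) = z (u \<otimes> g)" if "u \<in> carrier G" "g \<in> carrier G" for u g
    unfolding \<tau>_def
  proof (rule ext)
    fix i show "(\<lambda>i\<in>I. {h \<in> carrier G. h \<otimes> u \<in> z g i}) i = z (u \<otimes> g) i"
      using that by (auto simp: z_def recurrence_def m_assoc restrict_def)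
  qed
  have card_F: "card (F i h) \<le> card (F i \<one>)" if i: "i \<in> I" and h: "h \<in> carrier G" for i h
  proof (rule card_inj_on_le[OF _ _ finF])
    show "inj_on (\<tau> h) (F i h)"
    proof (rule inj_on_inverseI)
      fix \<zeta> assume "\<zeta> \<in> F i h"
      then obtain g where "\<zeta> = z g" "g \<in> carrier G" by (auto simp: F_def Z_def)
      then show "\<tau> (inv h) (\<tau> h \<zeta>) = \<zeta>"
        using h by (simp add: \<tau>_z flip: m_assoc)
    qed
    show "\<tau> h ` F i h \<subseteq> F i \<one>"
    proof
      fix \<xi> assume "\<xi> \<in> \<tau> h ` F i h"
      then obtain g where g: "g \<in> carrier G" "h \<in> z g i" "\<xi> = \<tau> h (z g)"
        by (auto simp: F_def Z_def)
      have "\<delta> (h \<otimes> g) = i" using g(2) i h by (simp add: z_def V_mem)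
      moreover have "\<xi> = z (h \<otimes> g)" using g h by (simp add: \<tau>_z)
      ultimately show "\<xi> \<in> F i \<one>"
        using i h g(1) by (simp add: F_def Z_def z_def V_mem)
    qed
  qed
  \<comment> \<open>Every translate of a fibre is nonempty, as \<delta> is onto. One chosen element
    from each of the at most \<open>K\<close> translates gives sets \<open>F i (c v)\<close> that
    cover \<open>Z\<close>, none larger than \<open>F i \<one>\<close>.\<close>
  have cover: "card Z \<le> K * card (F i \<one>)" if i: "i \<in> I" for i
  proof -
    have "\<exists>h. h \<in> carrier G \<and> h \<in> v" if v: "v \<in> ?V i ` carrier G" for v
    proof -
      obtain g where g: "g \<in> carrier G" "v = ?V i g" using v by blast
      obtain w where w: "w \<in> carrier G" "\<delta> w = i" using surj by (metis UNIV_I imageE)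
      have "w \<otimes> inv g \<in> v" using g w by (simp add: V_mem m_assoc)
      then show ?thesis using g w by blast
    qed
    then have "\<forall>v\<in>?V i ` carrier G. \<exists>h. h \<in> carrier G \<and> h \<in> v" by (rule ballI)
    from bchoice[OF this] obtain c
      where c: "\<And>v. v \<in> ?V i ` carrier G \<Longrightarrow> c v \<in> carrier G \<and> c v \<in> v" by auto
    have fin: "finite (?V i ` carrier G)" "card (?V i ` carrier G) \<le> K"
      using bound i by (auto simp: I_def)
    have "Z \<subseteq> (\<Union>v\<in>?V i ` carrier G. F i (c v))"
      using c i by (fastforce simp: Z_def F_def z_def)
    then have "card Z \<le> card (\<Union>v\<in>?V i ` carrier G. F i (c v))"
      using finF by (intro card_mono finite_UN_I[OF fin(1)])
    also have "\<dots> \<le> (\<Sum>v\<in>?V i ` carrier G. card (F i (c v)))"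
      by (rule card_UN_le[OF fin(1)])
    also have "\<dots> \<le> (\<Sum>v\<in>?V i ` carrier G. card (F i \<one>))"
      using c i by (intro sum_mono card_F) auto
    also have "\<dots> \<le> K * card (F i \<one>)" using fin(2) by simp
    finally show ?thesis .
  qed
  have "Suc K * card Z = (\<Sum>i\<in>I. card Z)" by (simp add: I_def)
  also have "\<dots> \<le> (\<Sum>i\<in>I. K * card (F i \<one>))" using cover by (rule sum_mono)
  also have "\<dots> = K * (\<Sum>i\<in>I. card (F i \<one>))" by (simp add: sum_distrib_left)
  also have "(\<Sum>i\<in>I. card (F i \<one>)) = card (\<Union>i\<in>I. F i \<one>)"
  proof (rule card_UN_disjoint[symmetric])
    show "\<forall>i\<in>I. \<forall>j\<in>I. i \<noteq> j \<longrightarrow> F i \<one> \<inter> F j \<one> = {}"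
      by (auto simp: F_def Z_def z_def V_mem)
  qed (auto simp: finF I_def)
  also have "\<dots> \<le> card Z" using finZ by (intro card_mono) (auto simp: F_def)
  finally have "card Z = 0" by simp
  moreover have "Z \<noteq> {}" by (auto simp: Z_def)
  ultimately show False using finZ by simp
qed

text \<open>If all sets agreeing with \<open>S\<^sub>0\<close> below \<open>m\<close> had fewer than
  \<open>k\<close> translates, this would hold for \<open>S\<^sub>0 \<inter> {..<m}\<close> and for
  it with one \<open>i \<ge> m\<close> added. The fibre over \<open>i\<close> is the difference of
  their preimages, so it would have at most \<open>k * k\<close> translates for every such
  \<open>i\<close>. The conclusion is a negated conjunction because \<open>card\<close> is 0 on
  infinite sets.\<close>

lemma recurrence_extension:
  fixes \<delta> :: "'a \<Rightarrow> nat"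
  assumes surj: "\<delta> ` carrier G = UNIV"
  shows "\<exists>S. S \<inter> {..<m} = S\<^sub>0 \<inter> {..<m} \<and>
             \<not> (finite (recurrence G \<delta> S ` carrier G) \<and> card (recurrence G \<delta> S ` carrier G) < k)"
proof (rule ccontr)
  let ?V = "recurrence G \<delta>"
  let ?C = "\<lambda>S. ?V S ` carrier G"
  assume neg: "\<not> ?thesis"
  have small: "finite (?C S) \<and> card (?C S) \<le> k" if "S \<inter> {..<m} = S\<^sub>0 \<inter> {..<m}" for S
  proof -
    have "finite (?C S) \<and> card (?C S) < k" using neg that by blast
    then show ?thesis by simp
  qed
  let ?A = "S\<^sub>0 \<inter> {..<m}"
  have "finite (?C {i}) \<and> card (?C {i}) \<le> k * k" if "i \<ge> m" for i
  proof -
    have A: "finite (?C ?A)" "card (?C ?A) \<le> k" using small[of ?A] by simp_all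
    have B: "finite (?C (insert i ?A))" "card (?C (insert i ?A)) \<le> k"
      using small[of "insert i ?A"] that by simp_all
    have sub: "?C {i} \<subseteq> (\<lambda>(a, b). b - a) ` (?C ?A \<times> ?C (insert i ?A))"
    proof
      fix v assume "v \<in> ?C {i}"
      then obtain g where "g \<in> carrier G" "v = ?V {i} g" by blast
      moreover have "?V {i} g = ?V (insert i ?A) g - ?V ?A g"
        using that by (auto simp: recurrence_def)
      ultimately show "v \<in> (\<lambda>(a, b). b - a) ` (?C ?A \<times> ?C (insert i ?A))"
        by (intro image_eqI[of _ _ "(?V ?A g, ?V (insert i ?A) g)"]) auto
    qed
    have fin: "finite (?C ?A \<times> ?C (insert i ?A))" using A B by simp
    have "card (?C {i}) \<le> card (?C ?A \<times> ?C (insert i ?A))"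
      using fin sub surj_card_le by blast
    also have "\<dots> \<le> k * k" using A B by (simp add: card_cartesian_product mult_le_mono)
    finally show ?thesis using finite_subset[OF sub] fin by blast
  qed
  then show False using fibres_recurrence_unbounded[OF surj, of m "k * k"] by blast
qed

end

section \<open>Finite approximations of the set of naturals\<close>

definition separated_by :: "bool list \<Rightarrow> nat \<Rightarrow> nat \<Rightarrow> bool" where
  "separated_by s a b \<longleftrightarrow> a < length s \<and> b < length s \<and> s ! a \<noteq> s ! b"

text \<open>Telling \<open>k\<close> translates apart takes one witness \<open>h\<close> per pair,
  hence only finitely many values of \<delta>. A long enough initial segment of the set
  \<open>S\<close> from \<open>recurrence_extension\<close> decides all of them.\<close>

lemma (in group) separating_extension:
  fixes \<delta> :: "'a \<Rightarrow> nat"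
  assumes surj: "\<delta> ` carrier G = UNIV"
  shows "\<exists>t. \<exists>gs\<in>lists (carrier G). length gs = k \<and>
           (\<forall>i<k. \<forall>j<i. \<exists>h\<in>carrier G. separated_by (s @ t) (\<delta> (h \<otimes> gs ! i)) (\<delta> (h \<otimes> gs ! j)))"
proof -
  let ?m = "length s"
  obtain S where S: "S \<inter> {..<?m} = {i. i < ?m \<and> s ! i} \<inter> {..<?m}"
    and large: "\<not> (finite (recurrence G \<delta> S ` carrier G) \<and> card (recurrence G \<delta> S ` carrier G) < k)"
    using recurrence_extension[OF surj, of ?m "{i. i < ?m \<and> s ! i}" k] by blast
  let ?V = "recurrence G \<delta> S"
  obtain W where W: "W \<subseteq> ?V ` carrier G" "finite W" "card W = k"
  proof (cases "finite (?V ` carrier G)")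
    case True
    then have "k \<le> card (?V ` carrier G)" using large by simp
    from obtain_subset_with_card_n[OF this] show thesis using that by blast
  next
    case False
    from infinite_arbitrarily_large[OF this] show thesis using that by blast
  qed
  obtain ws where ws: "set ws = W" "distinct ws" "length ws = k"
    using finite_distinct_list[OF W(2)] W(3) distinct_card by metis
  obtain gs where gs: "ws = map ?V gs" "gs \<in> lists (carrier G)"
  proof -
    have "ws \<in> map ?V ` lists (carrier G)"
      using W(1) ws(1) by (auto simp flip: lists_image)
    then show thesis using that by blast
  qed
  have len: "length gs = k" using ws gs by simp
  have "\<exists>h\<in>carrier G. (\<delta> (h \<otimes> gs ! i) \<in> S) \<noteq> (\<delta> (h \<otimes> gs ! j) \<in> S)" if "j < i" "i < k" for i j
  proof -
    have "ws ! i \<noteq> ws ! j" using ws that by (simp add: nth_eq_iff_index_eq)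
    then have "?V (gs ! i) \<noteq> ?V (gs ! j)" using gs(1) len that by simp
    then show ?thesis unfolding recurrence_def by blast
  qed
  then have "\<forall>i j. \<exists>h. j < i \<longrightarrow> i < k \<longrightarrow> h \<in> carrier G \<and>
      (\<delta> (h \<otimes> gs ! i) \<in> S) \<noteq> (\<delta> (h \<otimes> gs ! j) \<in> S)" by blast
  then obtain H where H: "\<And>i j. j < i \<Longrightarrow> i < k \<Longrightarrow> H i j \<in> carrier G \<and>
      (\<delta> (H i j \<otimes> gs ! i) \<in> S) \<noteq> (\<delta> (H i j \<otimes> gs ! j) \<in> S)"
    unfolding choice_iff by blast
  let ?D = "(\<lambda>(i, j, l). \<delta> (H i j \<otimes> gs ! l)) ` ({..<k} \<times> {..<k} \<times> {..<k})"
  obtain b where "\<forall>n\<in>?D. n < b"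
    using finite_nat_set_iff_bounded[of ?D] by auto
  then have b: "\<delta> (H i j \<otimes> gs ! l) < b" if "i < k" "j < k" "l < k" for i j l
    using that by auto
  \<comment> \<open>The characteristic function of \<open>S\<close> from \<open>length s\<close> on.
    Together with \<open>s\<close> it decides every natural below \<open>length s + b\<close>, in
    particular all values in \<open>?D\<close>.\<close>
  define t where "t = map (\<lambda>n. n \<in> S) [?m..<?m + b]"
  have nth: "(s @ t) ! n \<longleftrightarrow> n \<in> S" if "n < ?m + b" for n
  proof (cases "n < ?m")
    case True
    then show ?thesis using S by (auto simp: nth_append)
  qed (use that in \<open>auto simp: nth_append t_def\<close>)
  have "separated_by (s @ t) (\<delta> (H i j \<otimes> gs ! i)) (\<delta> (H i j \<otimes> gs ! j))" if "j < i" "i < k" for i j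
    using H[OF that] b[of i j i] b[of i j j] that nth by (simp add: separated_by_def t_def trans_less_add2)
  then show ?thesis using H gs(2) len by blast
qed

section \<open>Borel actions of countable groups\<close>

text \<open>The enumeration \<gamma>, possibly with repetitions, turns quantifiers over the group
  into countable ones over naturals, under which measurability is preserved.\<close>

locale borel_action = group_action G "space M" \<phi>
  for G :: "('g, 'm) monoid_scheme" (structure) and M :: "'a measure" and \<phi> +
  fixes \<gamma> :: "nat \<Rightarrow> 'g"
  assumes range_enum: "range \<gamma> = carrier G"
    and measurable_act: "g \<in> carrier G \<Longrightarrow> \<phi> g \<in> measurable M M"
begin

lemma group_G: "group G"
  using group_hom by (rule group_hom.axioms(1))

lemma enum_closed [simp]: "\<gamma> n \<in> carrier G"
  using range_enum by auto

lemma measurable_enum_act [measurable]: "\<phi> (\<gamma> n) \<in> measurable M M"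
  by (simp add: measurable_act)

lemma act_closed: "g \<in> carrier G \<Longrightarrow> x \<in> space M \<Longrightarrow> \<phi> g x \<in> space M"
  using element_image by blast

lemma orbit_eq_range: "orbit G \<phi> x = range (\<lambda>n. \<phi> (\<gamma> n) x)"
  unfolding orbit_def range_enum[symmetric] by auto

lemma orbit_in_space: "x \<in> space M \<Longrightarrow> y \<in> orbit G \<phi> x \<Longrightarrow> y \<in> space M"
  using act_closed unfolding orbit_def by blast

lemma orbit_eq:
  assumes "x \<in> space M" and "y \<in> orbit G \<phi> x"
  shows "orbit G \<phi> y = orbit G \<phi> x"
proof -
  have y: "y \<in> space M" using assms by (rule orbit_in_space)
  then have "x \<in> orbit G \<phi> y" using assms orbit_sym by blast
  then show ?thesis
    using orbit_trans[OF assms(1) y _ assms(2)] orbit_trans[OF y assms(1)]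
      orbit_in_space[OF assms(1)] orbit_in_space[OF y] by blast
qed

section \<open>Borel maps sending each orbit onto the naturals\<close>

lemma measurable_finite_orbit_image:
  assumes [measurable]: "e \<in> borel_measurable M"
  shows "Measurable.pred M (\<lambda>x. finite (e ` orbit G \<phi> x \<inter> {..q :: real}))"
proof -
  \<comment> \<open>Finiteness becomes a countable condition: every value up to \<open>q\<close>
    already occurs among the first \<open>n\<close> terms.\<close>
  have "finite (range f \<inter> {..q}) \<longleftrightarrow> (\<exists>n. \<forall>j. f j \<le> q \<longrightarrow> (\<exists>i<n. f j = f i))"
    for f :: "nat \<Rightarrow> real"
  proof
    assume "finite (range f \<inter> {..q})"
    then obtain F where F: "finite F" "range f \<inter> {..q} = f ` F"
      using finite_subset_image[of "range f \<inter> {..q}" f UNIV] by auto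
    then obtain n where "\<forall>i\<in>F. i < n" using finite_nat_set_iff_bounded by auto
    moreover have "\<exists>i\<in>F. f j = f i" if "f j \<le> q" for j
    proof -
      have "f j \<in> f ` F" using that F(2) by (metis IntI atMost_iff rangeI)
      then show ?thesis by blast
    qed
    ultimately show "\<exists>n. \<forall>j. f j \<le> q \<longrightarrow> (\<exists>i<n. f j = f i)" by meson
  next
    assume "\<exists>n. \<forall>j. f j \<le> q \<longrightarrow> (\<exists>i<n. f j = f i)"
    then obtain n where n: "\<forall>j. f j \<le> q \<longrightarrow> (\<exists>i<n. f j = f i)" by blast
    have "range f \<inter> {..q} \<subseteq> f ` {..<n}"
    proof
      fix v assume "v \<in> range f \<inter> {..q}"
      then obtain j where "v = f j" "f j \<le> q" by auto
      then show "v \<in> f ` {..<n}" using n by (metis imageI lessThan_iff)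
    qed
    then show "finite (range f \<inter> {..q})" by (rule finite_subset) simp
  qed
  then show ?thesis
    unfolding orbit_eq_range image_image by simp
qed

lemma measurable_orbit_rank:
  assumes e [measurable]: "e \<in> borel_measurable M"
  defines "T x \<equiv> e ` orbit G \<phi> x"
  shows "(\<lambda>x. rank (closeness (T x) ` T x) (closeness (T x) (e x))) \<in> measurable M (count_space UNIV)"
proof -
  have [measurable]: "Measurable.pred M (\<lambda>x. finite (T x \<inter> {..q}))" for q
    unfolding T_def by (rule measurable_finite_orbit_image[OF e])
  have [measurable]: "(\<lambda>x. least_limit_point (T x)) \<in> borel_measurable M"
    unfolding least_limit_point_def
  proof (rule borel_measurable_cSUP)
    show "countable (\<rat> :: real set)" by (rule countable_rat)
  qed (measurable, rule least_limit_point_bdd)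
  have cl [measurable]: "(\<lambda>x. closeness (T x) (f x)) \<in> measurable M (count_space UNIV)"
    if [measurable]: "f \<in> borel_measurable M" for f
    unfolding closeness_def by measurable
  have "m \<in> closeness (T x) ` T x \<longleftrightarrow> (\<exists>j. closeness (T x) (e (\<phi> (\<gamma> j) x)) = m)" for m x
    unfolding T_def orbit_eq_range by auto
  then show ?thesis
    unfolding rank_def by simp
qed

text \<open>The set \<open>T x\<close> is constant on orbits, so on an orbit \<open>r\<close> is the
  composite of \<open>e\<close>, \<open>closeness\<close> and \<open>rank\<close>, which is onto.
  The last property allows \<open>r\<close> to be recovered from partial information that determines
  \<open>e\<close> along the orbit.\<close>

lemma orbit_surjection:
  fixes e :: "'a \<Rightarrow> real"
  assumes "e \<in> borel_measurable M" and "\<And>x. x \<in> space M \<Longrightarrow> e x \<in> {0..1}"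
    and inf: "\<And>x. x \<in> space M \<Longrightarrow> infinite (e ` orbit G \<phi> x)"
  obtains r :: "'a \<Rightarrow> nat" where "r \<in> measurable M (count_space UNIV)"
    and "\<And>x. x \<in> space M \<Longrightarrow> r ` orbit G \<phi> x = UNIV"
    and "\<And>x y. x \<in> space M \<Longrightarrow> y \<in> space M \<Longrightarrow>
           \<forall>g\<in>carrier G. e (\<phi> g x) = e (\<phi> g y) \<Longrightarrow> r x = r y"
proof
  define T where "T x = e ` orbit G \<phi> x" for x
  define r where "r x = rank (closeness (T x) ` T x) (closeness (T x) (e x))" for x
  show "r \<in> measurable M (count_space UNIV)"
    using measurable_orbit_rank[OF assms(1)] unfolding r_def T_def .
  show "r ` orbit G \<phi> x = UNIV" if x: "x \<in> space M" for x
  proof -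
    have "T x \<subseteq> {0..1}" using assms(2) orbit_in_space x by (auto simp: T_def)
    moreover have "infinite (T x)" using inf x by (simp add: T_def)
    ultimately have "rank (closeness (T x) ` T x) ` closeness (T x) ` T x = UNIV"
      by (intro rank_image_infinite infinite_closeness)
    moreover have "r ` orbit G \<phi> x = rank (closeness (T x) ` T x) ` closeness (T x) ` T x"
    proof -
      have "T y = T x" if "y \<in> orbit G \<phi> x" for y
        using orbit_eq[OF x that] by (simp add: T_def)
      then have "r ` orbit G \<phi> x =
          (\<lambda>y. rank (closeness (T x) ` T x) (closeness (T x) (e y))) ` orbit G \<phi> x"
        unfolding r_def by (intro image_cong) auto
      also have "\<dots> = rank (closeness (T x) ` T x) ` closeness (T x) ` (e ` orbit G \<phi> x)"
        by (simp add: image_image)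
      finally show ?thesis by (simp add: T_def)
    qed
    ultimately show ?thesis by simp
  qed
  show "r x = r y" if "x \<in> space M" "y \<in> space M"
    and same: "\<forall>g\<in>carrier G. e (\<phi> g x) = e (\<phi> g y)" for x y
  proof -
    have "T x = T y" using same[THEN bspec, OF enum_closed] by (simp add: T_def orbit_eq_range image_image)
    moreover have "e x = e y"
      using same[THEN bspec, OF monoid.one_closed[OF group.is_monoid[OF group_G]]] that(1,2)
      by (simp flip: id_eq_one)
    ultimately show ?thesis by (simp add: r_def)
  qed
qed

section \<open>Greedy construction of a set with infinitely many itineraries\<close>

definition many_separated :: "('a \<Rightarrow> nat) \<Rightarrow> 'a set \<Rightarrow> nat \<Rightarrow> bool list \<Rightarrow> bool" where
  "many_separated d \<Omega> k s \<longleftrightarrow> (\<exists>ys\<in>lists \<Omega>. length ys = k \<and>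
     (\<forall>i<k. \<forall>j<i. \<exists>h\<in>carrier G. separated_by s (d (\<phi> h (ys ! i))) (d (\<phi> h (ys ! j)))))"

text \<open>Stage \<open>Suc k\<close> appends the first bit list, in a fixed enumeration, that
  forces \<open>Suc k\<close> itineraries. Since \<open>LEAST\<close> makes the choice, the result
  depends only on \<open>d\<close> and the orbit and is measurable.\<close>

primrec greedy :: "('a \<Rightarrow> nat) \<Rightarrow> 'a set \<Rightarrow> nat \<Rightarrow> bool list" where
  "greedy d \<Omega> 0 = []"
| "greedy d \<Omega> (Suc k) =
     greedy d \<Omega> k @ from_nat (LEAST n. many_separated d \<Omega> (Suc k) (greedy d \<Omega> k @ from_nat n))"

definition chosen :: "('a \<Rightarrow> nat) \<Rightarrow> 'a set \<Rightarrow> nat set" where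
  "chosen d \<Omega> = {i. \<exists>k. i < length (greedy d \<Omega> k) \<and> greedy d \<Omega> k ! i}"

text \<open>The group statement is applied to \<open>\<delta> g = d (\<phi> g x)\<close> and carried
  to the orbit by \<open>g \<mapsto> \<phi> g x\<close>.\<close>

lemma many_separated_extension:
  assumes x: "x \<in> space M" and "d ` orbit G \<phi> x = UNIV"
  shows "\<exists>t. many_separated d (orbit G \<phi> x) k (s @ t)"
proof -
  define \<delta> where "\<delta> g = d (\<phi> g x)" for g
  have "\<delta> ` carrier G = UNIV"
    using assms(2) unfolding orbit_eq_range range_enum[symmetric] by (simp add: \<delta>_def image_image)
  from group.separating_extension[OF group_G this, of k s]
  obtain t gs where gs: "gs \<in> lists (carrier G)" "length gs = k"
    and sep: "\<And>i j. i < k \<Longrightarrow> j < i \<Longrightarrow>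
      \<exists>h\<in>carrier G. separated_by (s @ t) (\<delta> (h \<otimes> gs ! i)) (\<delta> (h \<otimes> gs ! j))"
    by blast
  have mem: "gs ! i \<in> carrier G" if "i < k" for i
    using gs that by (metis in_listsD nth_mem)
  have \<delta>: "\<delta> (h \<otimes> gs ! i) = d (\<phi> h (map (\<lambda>g. \<phi> g x) gs ! i))" if "i < k" "h \<in> carrier G" for h i
    using composition_rule[OF x that(2) mem[OF that(1)]] that gs by (simp add: \<delta>_def)
  show ?thesis unfolding many_separated_def
  proof (intro exI[of _ t] bexI[of _ "map (\<lambda>g. \<phi> g x) gs"] conjI allI impI)
    show "map (\<lambda>g. \<phi> g x) gs \<in> lists (orbit G \<phi> x)"
      using gs(1) by (auto simp: orbit_def) blast
    fix i j assume ij: "i < k" "j < i"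
    then have "j < k" by simp
    show "\<exists>h\<in>carrier G. separated_by (s @ t) (d (\<phi> h (map (\<lambda>g. \<phi> g x) gs ! i)))
        (d (\<phi> h (map (\<lambda>g. \<phi> g x) gs ! j)))"
      using sep[OF ij] \<delta>[OF ij(1)] \<delta>[OF \<open>j < k\<close>] by auto
  qed (use gs(2) in simp)
qed

lemma many_separated_greedy:
  assumes "x \<in> space M" and "d ` orbit G \<phi> x = UNIV"
  shows "many_separated d (orbit G \<phi> x) (Suc k) (greedy d (orbit G \<phi> x) (Suc k))"
proof -
  obtain t where "many_separated d (orbit G \<phi> x) (Suc k) (greedy d (orbit G \<phi> x) k @ t)"
    using many_separated_extension[OF assms] by blast
  then have "\<exists>n. many_separated d (orbit G \<phi> x) (Suc k) (greedy d (orbit G \<phi> x) k @ from_nat n)"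
    by (metis from_nat_to_nat)
  from LeastI_ex[OF this] show ?thesis by simp
qed

lemma greedy_prefix: "\<exists>t. greedy d \<Omega> (k + j) = greedy d \<Omega> k @ t"
  by (induction j) auto

text \<open>The stages are nested, so all those long enough to decide \<open>i\<close> agree on
  it.\<close>

lemma chosen_iff_greedy:
  assumes "i < length (greedy d \<Omega> k)"
  shows "i \<in> chosen d \<Omega> \<longleftrightarrow> greedy d \<Omega> k ! i"
proof -
  have "greedy d \<Omega> k ! i = greedy d \<Omega> l ! i" if "i < length (greedy d \<Omega> l)" for l
  proof -
    obtain t u where "greedy d \<Omega> k @ t = greedy d \<Omega> (k + l)" "greedy d \<Omega> l @ u = greedy d \<Omega> (k + l)"
      using greedy_prefix[of d \<Omega> k l] greedy_prefix[of d \<Omega> l k] by (metis add.commute)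
    then show ?thesis using assms that by (metis nth_append)
  qed
  then show ?thesis using assms unfolding chosen_def by blast
qed

text \<open>Lists of orbit points are replaced by lists of indices into \<gamma>, which form a
  countable type.\<close>

lemma measurable_many_separated:
  assumes [measurable]: "d \<in> measurable M (count_space UNIV)"
  shows "Measurable.pred M (\<lambda>x. many_separated d (orbit G \<phi> x) k s)"
proof -
  have "many_separated d (orbit G \<phi> x) k s \<longleftrightarrow> (\<exists>ns. length ns = k \<and> (\<forall>i<k. \<forall>j<i. \<exists>m.
      separated_by s (d (\<phi> (\<gamma> m) (\<phi> (\<gamma> (ns ! i)) x))) (d (\<phi> (\<gamma> m) (\<phi> (\<gamma> (ns ! j)) x)))))"
    (is "?L \<longleftrightarrow> ?R") for x
  proof
    assume ?L
    then obtain ys where ys: "ys \<in> lists (range (\<lambda>n. \<phi> (\<gamma> n) x))" "length ys = k"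
      "\<forall>i<k. \<forall>j<i. \<exists>m. separated_by s (d (\<phi> (\<gamma> m) (ys ! i))) (d (\<phi> (\<gamma> m) (ys ! j)))"
      unfolding many_separated_def orbit_eq_range range_enum[symmetric] by auto
    then obtain ns where "ys = map (\<lambda>n. \<phi> (\<gamma> n) x) ns" unfolding lists_image by blast
    then show ?R using ys(2,3) by (intro exI[of _ ns]) auto
  next
    assume ?R
    then obtain ns where "length ns = k" "\<forall>i<k. \<forall>j<i. \<exists>m.
      separated_by s (d (\<phi> (\<gamma> m) (\<phi> (\<gamma> (ns ! i)) x))) (d (\<phi> (\<gamma> m) (\<phi> (\<gamma> (ns ! j)) x)))" by blast
    then show ?L
      unfolding many_separated_def orbit_eq_range range_enum[symmetric]
      by (intro bexI[of _ "map (\<lambda>n. \<phi> (\<gamma> n) x) ns"]) auto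
  qed
  then show ?thesis unfolding separated_by_def by simp
qed

lemma measurable_greedy:
  assumes d: "d \<in> measurable M (count_space UNIV)"
  shows "(\<lambda>x. greedy d (orbit G \<phi> x) k) \<in> measurable M (count_space UNIV)"
proof (induction k)
  case (Suc k)
  have "(\<lambda>x. s @ from_nat (LEAST n. many_separated d (orbit G \<phi> x) (Suc k) (s @ from_nat n)))
      \<in> measurable M (count_space UNIV)" for s :: "bool list"
    using measurable_compose[OF measurable_Least[OF measurable_many_separated[OF d]],
        of "\<lambda>n. s @ from_nat n" "count_space UNIV"] by simp
  \<comment> \<open>The previous stage takes countably many values, so it may be treated as a
    constant \<open>s\<close>.\<close>
  from measurable_compose_countable[OF this Suc] show ?case by simp
qed simp

text \<open>If an orbit had only \<open>k\<close> itineraries, stage \<open>Suc k\<close> would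
  still supply \<open>Suc k\<close> points of it with pairwise different ones, since within its
  length the segment decides membership in \<open>A\<close>.\<close>

lemma infinite_itineraries:
  fixes d :: "'a \<Rightarrow> nat"
  assumes [measurable]: "d \<in> measurable M (count_space UNIV)"
    and surj: "\<And>x. x \<in> space M \<Longrightarrow> d ` orbit G \<phi> x = UNIV"
  obtains A where "A \<in> sets M"
    and "\<And>x. x \<in> space M \<Longrightarrow> infinite ((\<lambda>y. {n. \<phi> (\<gamma> n) y \<in> A}) ` orbit G \<phi> x)"
proof
  define A where "A = {x \<in> space M. d x \<in> chosen d (orbit G \<phi> x)}"
  note [measurable] = measurable_greedy[OF assms(1)]
  have "Measurable.pred M (\<lambda>x. \<exists>k s. greedy d (orbit G \<phi> x) k = s \<and> d x < length s \<and> s ! d x)"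
    by measurable
  then show "A \<in> sets M"
    unfolding A_def chosen_def by (simp add: pred_def)
  fix x assume x: "x \<in> space M"
  let ?X = "orbit G \<phi> x" and ?t = "\<lambda>y. {n. \<phi> (\<gamma> n) y \<in> A}"
  show "infinite (?t ` ?X)"
  proof
    assume fin: "finite (?t ` ?X)"
    define k where "k = card (?t ` ?X)"
    let ?s = "greedy d ?X (Suc k)"
    obtain ys where ys: "ys \<in> lists ?X" "length ys = Suc k"
      and sep: "\<And>i j. i < Suc k \<Longrightarrow> j < i \<Longrightarrow>
        \<exists>h\<in>carrier G. separated_by ?s (d (\<phi> h (ys ! i))) (d (\<phi> h (ys ! j)))"
      using many_separated_greedy[OF x surj[OF x], of k] unfolding many_separated_def by blast
    have in_A: "y \<in> A \<longleftrightarrow> ?s ! d y" if "y \<in> ?X" "d y < length ?s" for y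
      using chosen_iff_greedy[OF that(2)] orbit_eq[OF x that(1)] orbit_in_space[OF x that(1)]
      by (simp add: A_def)
    have neq: "?t (ys ! i) \<noteq> ?t (ys ! j)" if ij: "i < Suc k" "j < i" for i j
    proof -
      obtain m where m: "separated_by ?s (d (\<phi> (\<gamma> m) (ys ! i))) (d (\<phi> (\<gamma> m) (ys ! j)))"
        using sep[OF ij] range_enum by (metis rangeE)
      have "\<phi> (\<gamma> m) (ys ! l) \<in> ?X" if "l < Suc k" for l
      proof -
        have "ys ! l \<in> ?X" using ys that by (metis in_listsD nth_mem)
        then show ?thesis using orbit_eq[OF x] unfolding orbit_eq_range by blast
      qed
      then have "\<phi> (\<gamma> m) (ys ! i) \<in> A \<longleftrightarrow> \<phi> (\<gamma> m) (ys ! j) \<notin> A"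
        using m ij by (simp add: in_A separated_by_def)
      then show ?thesis by blast
    qed
    have "inj_on (\<lambda>i. ?t (ys ! i)) {..k}"
      by (rule linorder_inj_onI) (use neq in \<open>auto simp: less_Suc_eq_le dest: sym\<close>)
    moreover have "(\<lambda>i. ?t (ys ! i)) ` {..k} \<subseteq> ?t ` ?X"
      using ys by (auto simp: less_Suc_eq_le in_listsD)
    ultimately have "card {..k} \<le> k"
      unfolding k_def using fin by (intro card_inj_on_le)
    then show False by simp
  qed
qed

end

section \<open>The partition into four pieces\<close>

lemma borel_G_space_imp_borel_action:
  assumes "group G" and "countable (carrier G)" and "borel_G_space G M \<phi>"
  shows "borel_action G M \<phi> (from_nat_into (carrier G))"
proof -
  have act: "group_action G (space M) \<phi>"
    and meas: "(\<lambda>(g, x). \<phi> g x) \<in> measurable (count_space (carrier G) \<Otimes>\<^sub>M M) M"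
    using assms(3) by (auto simp: borel_G_space_def)
  have "\<phi> g \<in> measurable M M" if "g \<in> carrier G" for g
    using measurable_compose[OF measurable_Pair1' meas, of g] that by simp
  moreover have "carrier G \<noteq> {}" using assms(1) group.is_monoid monoid.one_closed by blast
  ultimately show ?thesis
    using act assms(2) by (simp add: borel_action_def borel_action_axioms_def)
qed

theorem theorem8p12:
  fixes G :: "('g, 'm) monoid_scheme"
    and M :: "'a measure"
    and \<phi> :: "'g \<Rightarrow> 'a \<Rightarrow> 'a"
    and E :: "('a \<times> 'a) set"
  assumes "group G" and "countable (carrier G)" and "infinite (carrier G)"
    and "aperiodic_G_space G M \<phi>"
    and "smooth_equiv M E"
    and "G_invariant_rel G M \<phi> E"
  shows "\<exists>P :: nat \<Rightarrow> 'a set. borel_partition M 4 P \<and>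
           (\<forall>x\<in>space M. \<forall>y\<in>space M. (x, y) \<notin> E \<longrightarrow>
              separates_points (translates G \<phi> (P ` {..<4})) x y)"
proof -
  have space: "borel_G_space G M \<phi>" and aperiodic: "\<And>x. x \<in> space M \<Longrightarrow> infinite (orbit G \<phi> x)"
    using assms(4) by (auto simp: aperiodic_G_space_def)
  define \<gamma> where "\<gamma> = from_nat_into (carrier G)"
  interpret group G by fact
  interpret borel_action G M \<phi> \<gamma>
    unfolding \<gamma>_def by (rule borel_G_space_imp_borel_action[OF assms(1,2) space])
  obtain h :: "'a \<Rightarrow> real" where h [measurable]: "h \<in> borel_measurable M"
    and h_iff: "\<And>x y. x \<in> space M \<Longrightarrow> y \<in> space M \<Longrightarrow> (x, y) \<in> E \<longleftrightarrow> h x = h y"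
    using assms(5) by (auto simp: smooth_equiv_def)
  have h_inv: "h (\<phi> g x) = h x" if x: "x \<in> space M" and g: "g \<in> carrier G" for g x
  proof -
    have "orbit G \<phi> x \<in> orbits G (space M) \<phi>" using x unfolding orbits_def by blast
    moreover have "x \<in> orbit G \<phi> x" "\<phi> g x \<in> orbit G \<phi> x"
      using orbit_refl[OF x] g unfolding orbit_def by auto
    ultimately have "(\<phi> g x, x) \<in> E" using assms(6) unfolding G_invariant_rel_def by blast
    then show ?thesis using h_iff act_closed x g by blast
  qed
  obtain e :: "'a \<Rightarrow> real" where e: "e \<in> borel_measurable M" "inj_on e (space M)" "range e \<subseteq> {0..1}"
    using space standard_borel_embeds_unit_interval unfolding borel_G_space_def by blast
  have "infinite (e ` orbit G \<phi> x)" if x: "x \<in> space M" for x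
  proof -
    have "inj_on e (orbit G \<phi> x)" using inj_on_subset[OF e(2)] orbit_in_space[OF x] by blast
    then show ?thesis using aperiodic[OF x] finite_imageD by blast
  qed
  moreover have "e x \<in> {0..1}" for x using e(3) by blast
  ultimately obtain d :: "'a \<Rightarrow> nat" where d: "d \<in> measurable M (count_space UNIV)"
      "\<And>x. x \<in> space M \<Longrightarrow> d ` orbit G \<phi> x = UNIV"
    using orbit_surjection[OF e(1)] by metis
  obtain A where A [measurable]: "A \<in> sets M"
    and A_inf: "\<And>x. x \<in> space M \<Longrightarrow> infinite ((\<lambda>y. {n. \<phi> (\<gamma> n) y \<in> A}) ` orbit G \<phi> x)"
    using infinite_itineraries[OF d] by metis
  \<comment> \<open>As \<open>ternary\<close> is injective, \<open>f\<close> takes infinitely many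
    values on each orbit, and it depends on the \<open>A\<close>-itinerary alone.\<close>
  define f where "f y = ternary {n. \<phi> (\<gamma> n) y \<in> A}" for y
  have f_inf: "infinite (f ` orbit G \<phi> x)" if "x \<in> space M" for x
  proof -
    have "f ` orbit G \<phi> x = ternary ` (\<lambda>y. {n. \<phi> (\<gamma> n) y \<in> A}) ` orbit G \<phi> x"
      by (simp add: f_def image_image)
    moreover have "inj_on ternary S" for S by (simp add: inj_on_def ternary_eq_iff)
    ultimately show ?thesis using A_inf[OF that] by (simp add: finite_image_iff)
  qed
  have f_meas: "f \<in> borel_measurable M"
    unfolding f_def by (rule measurable_ternary) measurable
  have f_unit: "f x \<in> {0..1}" for x unfolding f_def by (rule ternary_bounds)
  obtain r :: "'a \<Rightarrow> nat" where r [measurable]: "r \<in> measurable M (count_space UNIV)"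
    and r_surj: "\<And>x. x \<in> space M \<Longrightarrow> r ` orbit G \<phi> x = UNIV"
    and r_cong: "\<And>x y. x \<in> space M \<Longrightarrow> y \<in> space M \<Longrightarrow>
           \<forall>g\<in>carrier G. f (\<phi> g x) = f (\<phi> g y) \<Longrightarrow> r x = r y"
    by (rule orbit_surjection[of f, OF f_meas f_unit f_inf]) (assumption, rule that)
  define q :: "nat \<Rightarrow> real" where "q = from_nat_into \<rat>"
  have range_q: "range q = \<rat>"
    unfolding q_def using countable_rat Rats_0 by (intro range_from_nat_into) auto
  \<comment> \<open>On each orbit \<open>r\<close> takes every value, so every rational
    \<open>p\<close> is tested against the invariant \<open>h\<close> at some point of the
    orbit.\<close>
  define B where "B = {x \<in> space M. h x < q (r x)}"
  have [measurable]: "B \<in> sets M"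
    unfolding B_def by measurable
  \<comment> \<open>The values 0 to 3 number the atoms of \<open>A\<close> and
    \<open>B\<close>.\<close>
  define c :: "'a \<Rightarrow> nat" where "c x = (if x \<in> A then 2 else 0) + (if x \<in> B then 1 else 0)" for x
  define P where "P i = {x \<in> space M. c x = i}" for i
  have c_less: "c x < 4" for x by (simp add: c_def)
  have "borel_partition M 4 P"
    unfolding borel_partition_def
  proof (intro conjI allI impI)
    show "P i \<in> sets M" for i unfolding P_def c_def by measurable
    show "disjoint_family_on P {..<4}" by (auto simp: disjoint_family_on_def P_def)
    show "(\<Union>i<4. P i) = space M" using c_less by (auto simp: P_def)
  qed
  moreover have "(x, y) \<in> E" if x: "x \<in> space M" and y: "y \<in> space M"
    and nsep: "\<not> separates_points (translates G \<phi> (P ` {..<4})) x y" for x y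
  proof -
    have in_translate: "z \<in> \<phi> (inv\<^bsub>G\<^esub> g) ` P i \<longleftrightarrow> c (\<phi> g z) = i"
      if g: "g \<in> carrier G" and z: "z \<in> space M" for g z i
    proof
      assume "z \<in> \<phi> (inv\<^bsub>G\<^esub> g) ` P i"
      then obtain w where "w \<in> P i" "z = \<phi> (inv\<^bsub>G\<^esub> g) w" by blast
      then show "c (\<phi> g z) = i"
        using orbit_sym_aux[of "inv\<^bsub>G\<^esub> g" w z] g by (simp add: P_def)
    next
      assume "c (\<phi> g z) = i"
      then have "\<phi> g z \<in> P i" using act_closed[OF g z] by (simp add: P_def)
      moreover have "\<phi> (inv\<^bsub>G\<^esub> g) (\<phi> g z) = z" using orbit_sym_aux[OF g z] by simp
      ultimately show "z \<in> \<phi> (inv\<^bsub>G\<^esub> g) ` P i" by force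
    qed
    have c_eq: "c (\<phi> g x) = c (\<phi> g y)" if g: "g \<in> carrier G" for g
    proof -
      \<comment> \<open>This translate contains \<open>x\<close> by construction, so it must contain
        \<open>y\<close>.\<close>
      let ?Q = "\<phi> (inv\<^bsub>G\<^esub> g) ` P (c (\<phi> g x))"
      have "?Q \<in> translates G \<phi> (P ` {..<4})"
        unfolding translates_def using g c_less by blast
      then have "x \<in> ?Q \<longleftrightarrow> y \<in> ?Q"
        using nsep unfolding separates_points_def by blast
      then show ?thesis by (simp add: in_translate[OF g] x y)
    qed
    have A_eq: "\<phi> g x \<in> A \<longleftrightarrow> \<phi> g y \<in> A" and B_eq: "\<phi> g x \<in> B \<longleftrightarrow> \<phi> g y \<in> B"
      if g: "g \<in> carrier G" for g
      using c_eq[OF g] by (auto simp: c_def split: if_splits)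
    have f_eq: "f (\<phi> g x) = f (\<phi> g y)" if g: "g \<in> carrier G" for g
      using A_eq composition_rule[OF x enum_closed g, symmetric]
        composition_rule[OF y enum_closed g, symmetric] g by (simp add: f_def)
    have r_eq: "r (\<phi> g x) = r (\<phi> g y)" if g: "g \<in> carrier G" for g
      using f_eq composition_rule[OF x _ g, symmetric] composition_rule[OF y _ g, symmetric] g
      by (intro r_cong act_closed[OF g] x y) simp
    \<comment> \<open>Some \<open>g\<close> has \<open>r (\<phi> g x) = i\<close>, and then
      \<open>r (\<phi> g y) = i\<close> because the \<open>A\<close>-itineraries agree. Membership
      in \<open>B\<close> at these two points thus compares \<open>h x\<close> and
      \<open>h y\<close> with the same rational.\<close>
    have below: "h x < p \<longleftrightarrow> h y < p" if "p \<in> \<rat>" for p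
    proof -
      obtain i where i: "q i = p" using \<open>p \<in> \<rat>\<close> range_q by (metis rangeE)
      have "i \<in> r ` orbit G \<phi> x" using r_surj[OF x] by simp
      then obtain g where g: "g \<in> carrier G" "r (\<phi> g x) = i"
        unfolding orbit_def by auto
      then show ?thesis
        using B_eq[OF g(1)] r_eq[OF g(1)] i h_inv x y act_closed by (simp add: B_def)
    qed
    have "h x = h y"
    proof (rule ccontr)
      assume "h x \<noteq> h y"
      then have "min (h x) (h y) < max (h x) (h y)" by linarith
      from Rats_dense_in_real[OF this] obtain p
        where "p \<in> \<rat>" "min (h x) (h y) < p" "p < max (h x) (h y)" by blast
      then show False using below[of p] by (auto simp: min_def max_def split: if_splits)
    qed
    then show "(x, y) \<in> E" using h_iff x y by blast
  qed
  ultimately show ?thesis by blast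
qed

end
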